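(* Let $r$ be an integer with $r\ge 3$, and let $\mathcal{H}$ be an $r$-uniform hypergraph with no isolated vertex. If $\mathcal{H}$ has no cycle, then $hk(\mathcal{H})=1$.
   Context: A hypergraph $\mathcal{H}$ consists of a finite nonempty vertex set $V(\mathcal{H})$ and a set $E(\mathcal{H})$ of subsets of $V(\mathcal{H})$ called hyperedges. All hypergraphs may have isolated vertices (vertices in no hyperedge) but have no loops, so every hyperedge has at least two vertices. For a finite set $I$ disjoint from $V(\mathcal{H})$, $\mathcal{H}\cup I$ is the hypergraph with vertex set $V(\mathcal{H})\cup I$ and hyperedge set $E(\mathcal{H})$. For a digraph $D$ and a vertex $v$, the in-neighborhood is $N_D^-(v)=\{x : (x,v)\in A(D)\}$. The competition hypergraph $C\mathcal{H}(D)$ of $D$ is the hypergraph with vertex set $V(D)$ in which $e\subseteq V(D)$ is a hyperedge if and only if $|e|\ge 2$ and $e=N_D^-(v)$ for some vertex $v$ of $D$. The hypercompetition number $hk(\mathcal{H})$ is the smallest integer $k\ge 0$ such that $\mathcal{H}\cup I$, where $I$ is a set of $k$ new isolated vertices, is the competition hypergraph of some acyclic digraph (one with no directed cycles, in particular no loops). A hypergraph $\mathcal{H}$ is $r$-uniform, where $2\le r\le |V(\mathcal{H})|$, if every hyperedge has size $r$. A cycle in $\mathcal{H}$ is a sequence $v_0v_1\cdots v_k$ of vertices with $k\ge 2$, $v_0,\dots,v_{k-1}$ distinct and $v_k=v_0$, for which there exist $k$ distinct hyperedges $e_1,\dots,e_k$ with $\{v_{i-1},v_i\}\subseteq e_i$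 for each $1\le i\le k$. *)

theory Defs
  imports "Graph_Theory.Graph_Theory"
begin

record 'a hypergraph =
  hverts :: "'a set"
  hedges :: "'a set set"

definition is_hypergraph :: "'a hypergraph \<Rightarrow> bool" where
  "is_hypergraph H \<longleftrightarrow>
     finite (hverts H) \<and> hverts H \<noteq> {} \<and>
     (\<forall>e\<in>hedges H. e \<subseteq> hverts H \<and> card e \<ge> 2)"

definition isolated_vertex :: "'a hypergraph \<Rightarrow> 'a \<Rightarrow> bool" where
  "isolated_vertex H v \<longleftrightarrow> v \<in> hverts H \<and> (\<forall>e\<in>hedges H. v \<notin> e)"

definition uniform :: "nat \<Rightarrow> 'a hypergraph \<Rightarrow> bool" where
  "uniform r H \<longleftrightarrow> 2 \<le> r \<and> r \<le> card (hverts H) \<and> (\<forall>e\<in>hedges H. card e = r)"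

text \<open>The cycle $v_0 v_1 \ldots v_k$ is the list \<open>vs\<close> of length $k + 1$. A pair of distinct
  hyperedges sharing two vertices gives a cycle with $k = 2$.\<close>

definition hypergraph_cycle :: "'a hypergraph \<Rightarrow> 'a list \<Rightarrow> bool" where
  "hypergraph_cycle H vs \<longleftrightarrow>
     (\<exists>k\<ge>2. length vs = k + 1 \<and> set vs \<subseteq> hverts H \<and>
        distinct (take k vs) \<and> vs ! k = vs ! 0 \<and>
        (\<exists>e :: nat \<Rightarrow> 'a set. inj_on e {1..k} \<and>
           (\<forall>i\<in>{1..k}. e i \<in> hedges H \<and> {vs ! (i - 1), vs ! i} \<subseteq> e i)))"

text \<open>Intended for \<open>I\<close> finite and disjoint from \<open>hverts H\<close>.\<close>

definition add_isolated :: "'a hypergraph \<Rightarrow> 'a set \<Rightarrow> 'a hypergraph" where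
  "add_isolated H I = \<lparr>hverts = hverts H \<union> I, hedges = hedges H\<rparr>"

definition map_hypergraph :: "('a \<Rightarrow> 'b) \<Rightarrow> 'a hypergraph \<Rightarrow> 'b hypergraph" where
  "map_hypergraph f H = \<lparr>hverts = f ` hverts H, hedges = (\<lambda>e. f ` e) ` hedges H\<rparr>"

definition in_neighborhood :: "'a pair_pre_digraph \<Rightarrow> 'a \<Rightarrow> 'a set" where
  "in_neighborhood D v = {x. (x, v) \<in> parcs D}"

text \<open>In \<^const>\<open>pre_digraph.cycle\<close>, a cycle has at least one arc, and loops and pairs of
  opposite arcs count as cycles.\<close>

definition acyclic_digraph :: "'a pair_pre_digraph \<Rightarrow> bool" where
  "acyclic_digraph D \<longleftrightarrow> pair_fin_digraph D \<and> (\<nexists>p. pre_digraph.cycle (with_proj D) p)"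

definition competition_hypergraph :: "'a pair_pre_digraph \<Rightarrow> 'a hypergraph" where
  "competition_hypergraph D =
     \<lparr>hverts = pverts D,
      hedges = {e. e \<subseteq> pverts D \<and> card e \<ge> 2 \<and> (\<exists>v\<in>pverts D. e = in_neighborhood D v)}\<rparr>"

text \<open>The type \<open>'a\<close> need not have enough elements outside \<open>hverts H\<close>, so the \<open>k\<close> new isolated
  vertices are taken to be \<open>Inr 0, \<dots>, Inr (k - 1)\<close> in \<open>'a + nat\<close>, where \<open>H\<close> is embedded by
  \<open>Inl\<close>. Every hypergraph has such a \<open>k\<close>: with one new vertex for each hyperedge \<open>e\<close>, let
  \<open>e\<close> be the in-neighborhood of that vertex.\<close>

definition hypercompetition_number :: "'a hypergraph \<Rightarrow> nat" where
  "hypercompetition_number H =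
     (LEAST k. \<exists>D :: ('a + nat) pair_pre_digraph. acyclic_digraph D \<and>
        competition_hypergraph D = add_isolated (map_hypergraph Inl H) (Inr ` {..<k}))"

end

theory Submission
  imports Defs
begin

text \<open>
  The number is positive because a finite acyclic digraph has a sink, and a sink lies in no
  in-neighbourhood: without a new vertex, it would be an isolated vertex of \<open>H\<close>.

  For the upper bound, each hyperedge needs its own vertex, later than all of its elements in
  some linear order, of which it is to be the in-neighbourhood; the single new vertex may be one
  of these. A family of hyperedges without a cycle, if nonempty, has a hyperedge \<open>g\<close> with a
  private vertex \<open>a\<close>, one that no other hyperedge contains
  (\<open>cycle_free_imp_private_vertex\<close>): otherwise a path could always be prolonged, since running
  back into itself would close a cycle. Suppose the remaining hyperedges have been served
  already, with the help of one extra vertex. None of them contains \<open>a\<close>, so \<open>a\<close> can be moved to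
  the end of the order and take over the role of their extra vertex, and the new vertex becomes
  free to serve \<open>g\<close>
  (\<open>private_vertices_imp_targets\<close>). Thus one extra vertex suffices however many hyperedges
  there are.
\<close>

section \<open>Private vertices in cycle-free families\<close>

lemma hypergraph_cycleI:
  assumes "k \<ge> 2" and inj_u: "inj_on u {..<k}" and u: "u ` {..<k} \<subseteq> hverts H"
    and inj_e: "inj_on e {..<k}" and e: "\<And>i. i < k \<Longrightarrow> e i \<in> hedges H"
    and step: "\<And>i. Suc i < k \<Longrightarrow> u i \<in> e i \<and> u (Suc i) \<in> e i"
    and last: "u (k - 1) \<in> e (k - 1)" "u 0 \<in> e (k - 1)"
  shows "\<exists>vs. hypergraph_cycle H vs"
proof -
  let ?vs = "map u [0..<k] @ [u 0]"
  have nth: "?vs ! i = (if i < k then u i else u 0)" if "i \<le> k" for i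
    using that by (auto simp: nth_append)
  have "inj_on (\<lambda>i. e (i - 1)) {1..k}"
  proof (rule inj_onI)
    fix i j assume ij: "i \<in> {1..k}" "j \<in> {1..k}" "e (i - 1) = e (j - 1)"
    then have "i - 1 = j - 1" using inj_onD[OF inj_e, of "i - 1" "j - 1"] by force
    with ij(1,2) show "i = j" by auto
  qed
  moreover have "e (i - 1) \<in> hedges H \<and> {?vs ! (i - 1), ?vs ! i} \<subseteq> e (i - 1)"
    if i: "i \<in> {1..k}" for i
  proof (cases "i = k")
    case True
    then show ?thesis using e[of "k - 1"] last nth[of "k - 1"] nth[of k] \<open>k \<ge> 2\<close> by auto
  next
    case False
    then show ?thesis using i e[of "i - 1"] step[of "i - 1"] nth[of "i - 1"] nth[of i] by auto
  qed
  moreover have "distinct (take k ?vs)"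
    using inj_u by (simp add: distinct_map atLeast0LessThan)
  moreover have "set ?vs \<subseteq> hverts H"
    using u \<open>k \<ge> 2\<close> by (auto simp: image_subset_iff)
  moreover have "length ?vs = k + 1" "?vs ! k = ?vs ! 0"
    using nth[of k] nth[of 0] by simp_all
  ultimately have "hypergraph_cycle H ?vs"
    unfolding hypergraph_cycle_def using \<open>k \<ge> 2\<close> by blast
  then show ?thesis ..
qed

definition hyperedge_path :: "'a set set \<Rightarrow> (nat \<Rightarrow> 'a) \<Rightarrow> (nat \<Rightarrow> 'a set) \<Rightarrow> nat \<Rightarrow> bool" where
  "hyperedge_path F v e n \<longleftrightarrow>
     inj_on v {..n} \<and> v ` {..n} \<subseteq> \<Union>F \<and> inj_on e {..<n} \<and> e ` {..<n} \<subseteq> F \<and>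
     (\<forall>i<n. v i \<in> e i \<and> v (Suc i) \<in> e i)"

text \<open>A hyperedge leading from the end of a path back to an earlier vertex closes a cycle with
  the part of the path in between. It may be a hyperedge of the path, provided that it was
  used before that part.\<close>

lemma hyperedge_path_closes_cycle:
  assumes H: "is_hypergraph H" and F: "F \<subseteq> hedges H" and path: "hyperedge_path F v e n"
    and "j < n" and g: "g \<in> F" "g \<notin> e ` {j..<n}" "v j \<in> g" "v n \<in> g"
  shows "\<exists>vs. hypergraph_cycle H vs"
proof (rule hypergraph_cycleI)
  let ?k = "Suc (n - j)"
  let ?u = "\<lambda>i. v (j + i)" and ?e = "\<lambda>i. if i < n - j then e (j + i) else g"
  have inj_v: "inj_on v {..n}" and v: "\<And>i. i \<le> n \<Longrightarrow> v i \<in> \<Union>F" and inj_e: "inj_on e {..<n}"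
    and e: "\<And>i. i < n \<Longrightarrow> e i \<in> F" and step: "\<And>i. i < n \<Longrightarrow> v i \<in> e i \<and> v (Suc i) \<in> e i"
    using path by (auto simp: hyperedge_path_def)
  show "?k \<ge> 2" using \<open>j < n\<close> by simp
  show "inj_on ?u {..<?k}"
    using inj_onD[OF inj_v] \<open>j < n\<close> by (fastforce intro: inj_onI)
  have "\<Union>F \<subseteq> hverts H" using H F by (auto simp: is_hypergraph_def)
  then show "?u ` {..<?k} \<subseteq> hverts H" using v \<open>j < n\<close> by force
  show "inj_on ?e {..<?k}"
  proof (rule inj_onI)
    fix x y assume xy: "x \<in> {..<?k}" "y \<in> {..<?k}" "?e x = ?e y"
    have new: "e (j + i) \<noteq> g" if "i < n - j" for i using g(2) that by force
    show "x = y"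
    proof (cases "x < n - j \<and> y < n - j")
      case True
      then show ?thesis using xy(3) inj_onD[OF inj_e, of "j + x" "j + y"] by auto
    next
      case False
      then show ?thesis using xy new[of x] new[of y] by (auto split: if_splits)
    qed
  qed
  show "?e i \<in> hedges H" if "i < ?k" for i
    using that e[of "j + i"] g(1) F by auto
  show "?u i \<in> ?e i \<and> ?u (Suc i) \<in> ?e i" if "Suc i < ?k" for i
    using that step[of "j + i"] by auto
  show "?u (?k - 1) \<in> ?e (?k - 1)" "?u 0 \<in> ?e (?k - 1)"
    using g \<open>j < n\<close> by simp_all
qed

lemma cycle_free_imp_private_vertex:
  assumes H: "is_hypergraph H" and acyc: "\<nexists>vs. hypergraph_cycle H vs"
    and F: "F \<subseteq> hedges H" "F \<noteq> {}"
  shows "\<exists>g\<in>F. \<exists>a\<in>g. \<forall>g'\<in>F. a \<in> g' \<longrightarrow> g' = g"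
proof (rule ccontr)
  assume no_private: "\<not> ?thesis"
  have card2: "card g \<ge> 2" if "g \<in> F" for g
    using that H F(1) by (auto simp: is_hypergraph_def)
  have "hedges H \<subseteq> Pow (hverts H)" "finite (hverts H)" using H by (auto simp: is_hypergraph_def)
  then have finF: "finite F" using F(1) by (meson finite_Pow_iff finite_subset)
  have path_exists: "\<exists>v e. hyperedge_path F v e n" for n
  proof (induction n)
    case 0
    obtain g where "g \<in> F" using F(2) by blast
    then obtain a where "a \<in> g" using card2[of g] by fastforce
    then have "hyperedge_path F (\<lambda>_. a) (\<lambda>_. g) 0"
      using \<open>g \<in> F\<close> by (auto simp: hyperedge_path_def)
    then show ?case by blast
  next
    case (Suc n)
    then obtain v e where path: "hyperedge_path F v e n" by blast
    then have inj_v: "inj_on v {..n}" and v: "\<And>i. i \<le> n \<Longrightarrow> v i \<in> \<Union>F" and inj_e: "inj_on e {..<n}"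
      and e: "\<And>i. i < n \<Longrightarrow> e i \<in> F" and step: "\<And>i. i < n \<Longrightarrow> v i \<in> e i \<and> v (Suc i) \<in> e i"
      by (auto simp: hyperedge_path_def)
    note close = hyperedge_path_closes_cycle[OF H F(1) path]
    \<comment> \<open>Leave the end of the path by a hyperedge other than the one through which it was
      reached.\<close>
    obtain g where g: "g \<in> F" "v n \<in> g" "n > 0 \<longrightarrow> g \<noteq> e (n - 1)"
      using no_private v[of n] by (metis UnionE le_refl)
    have new_edge: "g \<notin> e ` {..<n}"
    proof
      assume "g \<in> e ` {..<n}"
      then obtain j where j: "j < n" "g = e j" by blast
      with g(3) have "Suc j < n" by (cases "j = n - 1") auto
      moreover have "g \<notin> e ` {Suc j..<n}"
        using j inj_onD[OF inj_e, of j] by fastforce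
      ultimately show False using close[of "Suc j" g] g step[of j] j acyc by blast
    qed
    have "\<not> g \<subseteq> {v n}" using card2[OF g(1)] card_mono[of "{v n}" g] by auto
    then obtain u where u: "u \<in> g" "u \<noteq> v n" by blast
    have "u \<notin> v ` {..n}"
    proof
      assume "u \<in> v ` {..n}"
      then obtain j where "j \<le> n" "u = v j" by blast
      with u have "j < n" by (cases "j = n") auto
      moreover have "g \<notin> e ` {j..<n}" using new_edge by auto
      ultimately show False using close[of j g] g u \<open>u = v j\<close> acyc by blast
    qed
    then have "inj_on (v(Suc n := u)) {..Suc n}"
      using inj_v by (simp add: atMost_Suc inj_on_fun_updI)
    moreover have "v(Suc n := u) ` {..Suc n} \<subseteq> \<Union>F"
      using v u(1) g(1) by (fastforce simp: le_Suc_eq)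
    moreover have "inj_on (e(n := g)) {..<Suc n}"
      using inj_e new_edge by (simp add: lessThan_Suc inj_on_fun_updI)
    moreover have "e(n := g) ` {..<Suc n} \<subseteq> F"
      using e g(1) by (auto simp: less_Suc_eq)
    moreover have "\<forall>i<Suc n. (v(Suc n := u)) i \<in> (e(n := g)) i \<and>
        (v(Suc n := u)) (Suc i) \<in> (e(n := g)) i"
      using step g(2) u(1) by (simp add: less_Suc_eq)
    ultimately show ?case unfolding hyperedge_path_def by blast
  qed
  \<comment> \<open>The hyperedges of a path are distinct, so none is longer than the family.\<close>
  obtain v e where "hyperedge_path F v e (Suc (card F))" using path_exists by blast
  then have "inj_on e {..<Suc (card F)}" "e ` {..<Suc (card F)} \<subseteq> F"
    unfolding hyperedge_path_def by blast+
  then show False using card_inj_on_le[OF _ _ finF] by fastforce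
qed

section \<open>Serving all hyperedges with one extra vertex\<close>

text \<open>\<^term>\<open>t e\<close> is the vertex that is to have in-neighbourhood \<^term>\<open>e\<close>, where \<^const>\<open>None\<close>
  stands for the extra vertex, and \<^term>\<open>rank\<close> is the order certifying acyclicity. The extra
  vertex comes last, so being served by it imposes no condition on \<^term>\<open>rank\<close>.\<close>

lemma private_vertices_imp_targets:
  assumes "finite E" and "\<And>e. e \<in> E \<Longrightarrow> finite e"
    and "\<And>F. F \<subseteq> E \<Longrightarrow> F \<noteq> {} \<Longrightarrow> \<exists>g\<in>F. \<exists>a\<in>g. \<forall>g'\<in>F. a \<in> g' \<longrightarrow> g' = g"
  shows "\<exists>(t :: 'a set \<Rightarrow> 'a option) (rank :: 'a \<Rightarrow> nat).
           inj_on t E \<and> t ` E \<subseteq> insert None (Some ` \<Union>E) \<and>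
           (\<forall>e\<in>E. \<forall>x\<in>e. \<forall>y. t e = Some y \<longrightarrow> rank x < rank y)"
  using assms
proof (induction E rule: finite_psubset_induct)
  case (psubset E)
  show ?case
  proof (cases "E = {}")
    case True
    then show ?thesis by simp
  next
    case False
    then obtain g a where g: "g \<in> E" "a \<in> g" and priv: "\<forall>g'\<in>E. a \<in> g' \<longrightarrow> g' = g"
      using psubset.prems(2)[of E] by blast
    let ?E = "E - {g}"
    have "?E \<subset> E" using g by blast
    moreover have "finite e" if "e \<in> ?E" for e using that psubset.prems(1) by blast
    moreover have "\<exists>h\<in>F. \<exists>b\<in>h. \<forall>h'\<in>F. b \<in> h' \<longrightarrow> h' = h" if "F \<subseteq> ?E" "F \<noteq> {}" for F
      using that psubset.prems(2)[of F] by blast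
    ultimately have "\<exists>(t :: 'a set \<Rightarrow> 'a option) (rank :: 'a \<Rightarrow> nat).
        inj_on t ?E \<and> t ` ?E \<subseteq> insert None (Some ` \<Union>?E) \<and>
        (\<forall>e\<in>?E. \<forall>x\<in>e. \<forall>y. t e = Some y \<longrightarrow> rank x < rank y)"
      by (rule psubset.IH)
    then obtain t :: "'a set \<Rightarrow> 'a option" and rank :: "'a \<Rightarrow> nat"
      where inj: "inj_on t ?E" and t: "t ` ?E \<subseteq> insert None (Some ` \<Union>?E)"
        and rank: "\<forall>e\<in>?E. \<forall>x\<in>e. \<forall>y. t e = Some y \<longrightarrow> rank x < rank y"
      by (elim exE conjE)
    have a: "a \<notin> \<Union>?E" using priv by blast
    have "finite (rank ` \<Union>E)" using psubset.hyps psubset.prems(1) by blast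
    then obtain N where N: "\<And>x. x \<in> \<Union>E \<Longrightarrow> rank x < N"
      by (metis finite_nat_set_iff_bounded imageI)
    define t' where "t' e = (if e = g then None else Some (case t e of None \<Rightarrow> a | Some y \<Rightarrow> y))" for e
    define rank' where "rank' = rank(a := N)"
    have t_in: "y \<in> \<Union>?E" if "e \<in> ?E" "t e = Some y" for e y
    proof -
      have "Some y \<in> t ` ?E" using that by force
      then show ?thesis using t by auto
    qed
    have "inj_on t' E"
    proof (rule inj_onI)
      fix e f assume ef: "e \<in> E" "f \<in> E" "t' e = t' f"
      show "e = f"
      proof (cases "e = g \<or> f = g")
        case True
        then show ?thesis using ef by (auto simp: t'_def split: if_splits)
      next
        case False
        then have E': "e \<in> ?E" "f \<in> ?E" using ef by auto
        have "t e = t f"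
          using ef(3) False t_in[OF E'(1)] t_in[OF E'(2)] a
          by (auto simp: t'_def split: option.splits)
        then show ?thesis using inj E' by (auto dest: inj_onD)
      qed
    qed
    moreover have "t' ` E \<subseteq> insert None (Some ` \<Union>E)"
    proof
      fix z assume "z \<in> t' ` E"
      then obtain e where e: "e \<in> E" "z = t' e" by blast
      show "z \<in> insert None (Some ` \<Union>E)"
      proof (cases "e = g")
        case False
        then have "e \<in> ?E" using e by blast
        then show ?thesis using e False t_in[of e] g
          by (cases "t e") (auto simp: t'_def)
      qed (simp add: e t'_def)
    qed
    moreover have "rank' x < rank' y" if e: "e \<in> E" "x \<in> e" "t' e = Some y" for e x y
    proof -
      have "e \<noteq> g" using e(3) by (auto simp: t'_def)
      then have eE: "e \<in> ?E" using e by blast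
      then have x: "x \<noteq> a" "x \<in> \<Union>E" using a e by auto
      show ?thesis
      proof (cases "t e")
        case None
        then have "y = a" using e(3) \<open>e \<noteq> g\<close> by (simp add: t'_def)
        then show ?thesis using x N by (simp add: rank'_def)
      next
        case (Some z)
        then have "y = z" using e(3) \<open>e \<noteq> g\<close> by (simp add: t'_def)
        then have "y \<noteq> a" using t_in[OF eE Some] a by auto
        then show ?thesis using rank eE e(2) Some x \<open>y = z\<close> by (simp add: rank'_def)
      qed
    qed
    ultimately show ?thesis by blast
  qed
qed

section \<open>Acyclic digraphs\<close>

lemma acyclic_digraph_iff_acyclic_parcs:
  "acyclic_digraph D \<longleftrightarrow> pair_fin_digraph D \<and> acyclic (parcs D)"
proof (cases "pair_fin_digraph D")
  case True
  then interpret pair_fin_digraph D .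
  have "(\<exists>p. pre_digraph.cycle (with_proj D) p) \<longleftrightarrow> (\<exists>u p. awalk u p u \<and> p \<noteq> [])"
    using closed_w_imp_cycle unfolding closed_w_def cycle_def by blast
  also have "\<dots> \<longleftrightarrow> \<not> acyclic (parcs D)"
    using reachable1_awalk by (auto simp: acyclic_def)
  finally show ?thesis using True by (simp add: acyclic_digraph_def)
qed (simp add: acyclic_digraph_def)

lemma acyclic_digraph_has_sink:
  assumes "acyclic_digraph D" and "pverts D \<noteq> {}"
  shows "\<exists>x\<in>pverts D. \<forall>v. (x, v) \<notin> parcs D"
proof -
  interpret pair_fin_digraph D
    using assms(1) by (simp add: acyclic_digraph_def)
  have "wf ((parcs D)\<inverse>)"
    using assms(1) pair_finite_arcs
    by (simp add: acyclic_digraph_iff_acyclic_parcs finite_acyclic_wf_converse)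
  then obtain x where "x \<in> pverts D" "\<And>y. (y, x) \<in> (parcs D)\<inverse> \<Longrightarrow> y \<notin> pverts D"
    using assms(2) by (metis ex_in_conv wfE_min)
  then show ?thesis using in_arcsD2 by blast
qed

section \<open>The hypercompetition number\<close>

lemma competition_hypergraph_has_isolated_vertex:
  assumes "acyclic_digraph D" and "pverts D \<noteq> {}"
  shows "\<exists>x. isolated_vertex (competition_hypergraph D) x"
  using acyclic_digraph_has_sink[OF assms]
  by (auto simp: isolated_vertex_def competition_hypergraph_def in_neighborhood_def)

lemma competition_hypergraph_with_one_extra_vertex:
  assumes H: "is_hypergraph H" and acyc: "\<nexists>vs. hypergraph_cycle H vs"
  shows "\<exists>D :: ('a + nat) pair_pre_digraph. acyclic_digraph D \<and>
    competition_hypergraph D = add_isolated (map_hypergraph Inl (H :: 'a hypergraph)) (Inr ` {..<1})"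
proof -
  have fin: "finite (hverts H)" and sub: "\<And>e. e \<in> hedges H \<Longrightarrow> e \<subseteq> hverts H"
    and card2: "\<And>e. e \<in> hedges H \<Longrightarrow> card e \<ge> 2"
    using H by (auto simp: is_hypergraph_def)
  have "finite (hedges H)"
    using fin sub by (meson PowI finite_Pow_iff finite_subset subsetI)
  then have "\<exists>(t :: 'a set \<Rightarrow> 'a option) (rank :: 'a \<Rightarrow> nat).
      inj_on t (hedges H) \<and> t ` hedges H \<subseteq> insert None (Some ` \<Union>(hedges H)) \<and>
      (\<forall>e\<in>hedges H. \<forall>x\<in>e. \<forall>y. t e = Some y \<longrightarrow> rank x < rank y)"
    using finite_subset[OF sub fin] cycle_free_imp_private_vertex[OF H acyc]
    by (rule private_vertices_imp_targets)
  then obtain t :: "'a set \<Rightarrow> 'a option" and rank :: "'a \<Rightarrow> nat"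
    where inj: "inj_on t (hedges H)" and t: "t ` hedges H \<subseteq> insert None (Some ` \<Union>(hedges H))"
      and rank: "\<forall>e\<in>hedges H. \<forall>x\<in>e. \<forall>y. t e = Some y \<longrightarrow> rank x < rank y"
    by (elim exE conjE)
  define vertex :: "'a option \<Rightarrow> 'a + nat" where "vertex = case_option (Inr 0) Inl"
  have vertex_inj: "vertex p = vertex q \<longleftrightarrow> p = q" for p q
    by (auto simp: vertex_def split: option.splits)
  define V where "V = Inl ` hverts H \<union> Inr ` {..<1::nat}"
  define D where "D = \<lparr>pverts = V, parcs = {(Inl x, vertex (t e)) | x e. e \<in> hedges H \<and> x \<in> e}\<rparr>"
  have t_in: "vertex (t e) \<in> V" if "e \<in> hedges H" for e
  proof -
    have "t e \<in> insert None (Some ` \<Union>(hedges H))" using t that by blast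
    moreover have "\<Union>(hedges H) \<subseteq> hverts H" using sub by blast
    ultimately show ?thesis by (auto simp: vertex_def V_def)
  qed
  have arcs: "parcs D \<subseteq> V \<times> V"
    using t_in sub by (auto simp: D_def V_def)
  have finV: "finite V" using fin by (simp add: V_def)
  have verts: "pverts D = V" by (simp add: D_def)
  have "pair_fin_digraph D"
  proof
    show "finite (pverts D)" using finV verts by simp
    show "finite (parcs D)" using arcs finV by (meson finite_SigmaI finite_subset)
  qed (use arcs verts in auto)
  moreover have "acyclic (parcs D)"
  proof -
    obtain N where N: "\<And>x. x \<in> hverts H \<Longrightarrow> rank x < N"
      using fin by (metis finite_imageI finite_nat_set_iff_bounded imageI)
    have "parcs D \<subseteq> measure (case_sum rank (\<lambda>_. N))"
      using rank N sub by (fastforce simp: D_def vertex_def split: option.splits)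
    then show ?thesis by (meson wf_acyclic wf_measure wf_subset)
  qed
  ultimately have "acyclic_digraph D" by (simp add: acyclic_digraph_iff_acyclic_parcs)
  moreover have "hedges (competition_hypergraph D) = (`) Inl ` hedges H"
  proof -
    have nbh: "in_neighborhood D (vertex (t e)) = Inl ` e" if "e \<in> hedges H" for e
      using that inj by (auto simp: in_neighborhood_def D_def vertex_inj dest: inj_onD)
    have other: "in_neighborhood D v = {}" if "v \<notin> vertex ` t ` hedges H" for v
      using that by (auto simp: in_neighborhood_def D_def)
    show ?thesis
    proof (intro equalityI subsetI)
      fix f assume "f \<in> hedges (competition_hypergraph D)"
      then obtain v where v: "f = in_neighborhood D v" and "card f \<ge> 2"
        by (auto simp: competition_hypergraph_def)
      then have "v \<in> vertex ` t ` hedges H" using other[of v] by fastforce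
      then show "f \<in> (`) Inl ` hedges H" using v nbh by auto
    next
      fix f :: "('a + nat) set" assume "f \<in> (`) Inl ` hedges H"
      then obtain e where e: "e \<in> hedges H" "f = Inl ` e" by blast
      then show "f \<in> hedges (competition_hypergraph D)"
        using nbh[OF e(1)] t_in[OF e(1)] card2[OF e(1)] sub[OF e(1)]
        by (auto simp: competition_hypergraph_def D_def V_def card_image)
    qed
  qed
  ultimately show ?thesis
    by (intro exI[of _ D])
      (simp add: competition_hypergraph_def add_isolated_def map_hypergraph_def D_def V_def)
qed

theorem theorem2p10:
  fixes r :: nat and H :: "'a hypergraph"
  assumes "r \<ge> 3"
    and "is_hypergraph H"
    and "uniform r H"
    and "\<nexists>v. isolated_vertex H v"
    and "\<nexists>vs. hypergraph_cycle H vs"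
  shows "hypercompetition_number H = 1"
  unfolding hypercompetition_number_def
proof (rule Least_equality)
  show "\<exists>D :: ('a + nat) pair_pre_digraph. acyclic_digraph D \<and>
    competition_hypergraph D = add_isolated (map_hypergraph Inl H) (Inr ` {..<1})"
    by (rule competition_hypergraph_with_one_extra_vertex[OF assms(2,5)])
next
  fix k
  assume "\<exists>D :: ('a + nat) pair_pre_digraph. acyclic_digraph D \<and>
    competition_hypergraph D = add_isolated (map_hypergraph Inl H) (Inr ` {..<k})"
  then obtain D :: "('a + nat) pair_pre_digraph" where D: "acyclic_digraph D"
    and eq: "competition_hypergraph D = add_isolated (map_hypergraph Inl H) (Inr ` {..<k})" by blast
  show "1 \<le> k"
  proof (rule ccontr)
    assume "\<not> 1 \<le> k"
    then have "k = 0" by simp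
    then have eq0: "competition_hypergraph D = map_hypergraph Inl H"
      using eq by (simp add: add_isolated_def map_hypergraph_def)
    have "pverts D = Inl ` hverts H"
      using arg_cong[OF eq0, of hverts] by (simp add: competition_hypergraph_def map_hypergraph_def)
    then have "pverts D \<noteq> {}" using assms(2) by (simp add: is_hypergraph_def)
    then obtain x where "isolated_vertex (map_hypergraph Inl H :: ('a + nat) hypergraph) x"
      using competition_hypergraph_has_isolated_vertex[OF D] eq0 by auto
    then have "\<exists>v. isolated_vertex H v"
      by (auto simp: isolated_vertex_def map_hypergraph_def)
    then show False using assms(4) by blast
  qed
qed

end
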